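(* For every integer $N \geq 1$, there exists a subset $S = S(N)$ of $\mathbb{R}$ such that $$\vert S \cap [m,m+1] \vert = 1 - \frac{1}{N}$$ for every $m \in \mathbb{Z}$, but such that $S$ does not contain any arithmetic progression $x + \Delta\mathbb{N} = \{x + n\Delta : n \in \mathbb{N}\}$ for any $x \in S$ and any $\Delta > 0$ in $\mathbb{R}$.
   Context: $\mathbb{N}$ denotes the natural numbers including $0$. For a Lebesgue measurable set $A \subseteq \mathbb{R}$, $\vert A \vert$ denotes its Lebesgue measure; writing $\vert A\vert$ presupposes that $A$ is Lebesgue measurable. *)

theory Defs
  imports "HOL-Analysis.Analysis"
begin

end

theory Submission
  imports Defs "HOL-Library.Discrete_Functions"
begin

text \<open>
  The complement of \<open>S\<close> is, inside each unit interval \<open>[m, m + 1)\<close>, an arc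
  \<open>m + [j/N, (j+1)/N)\<close>, where \<open>j\<close> is constant on each dyadic window \<open>[2^k, 2^(k+1))\<close> and runs
  cyclically through \<open>0, \<dots>, N - 1\<close> as \<open>k\<close> grows. By Dirichlet's theorem some multiple of the
  difference of a progression equals \<open>D = p + e\<close> with \<open>p\<close> an integer and \<open>\<bar>e\<bar> < 1/N\<close>. If
  \<open>e = 0\<close>, the progression with difference \<open>D\<close> has a constant fractional part, and it is caught
  in a window with the matching value of \<open>j\<close>. If \<open>e \<noteq> 0\<close>, its fractional parts walk around the
  circle in steps shorter than the arc, so every long enough window catches it.
\<close>

text \<open>For \<open>m \<le> 0\<close> this is arc \<open>0\<close>, because
  \<open>nat m = 0\<close> and \<open>floor_log 0 = 0\<close>. A progression with positive
  difference eventually leaves that region.\<close>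

definition arc_index :: "nat \<Rightarrow> int \<Rightarrow> nat" where
  "arc_index N m = floor_log (nat m) mod N"

definition avoiding_set :: "nat \<Rightarrow> real set" where
  "avoiding_set N = {t. \<lfloor>real N * frac t\<rfloor> \<noteq> int (arc_index N \<lfloor>t\<rfloor>)}"

text \<open>On a half-open unit interval \<open>\<lfloor>t\<rfloor>\<close> is constantly
  \<open>m\<close>, so a single arc is removed. If it touches an end of the interval, one of the two
  pieces is empty.\<close>

lemma avoiding_set_Int_unit_interval:
  assumes "N \<ge> 1"
  defines "j m \<equiv> real (arc_index N m)"
  shows "avoiding_set N \<inter> {of_int m..<of_int m + 1} =
    {of_int m..<of_int m + j m / N} \<union> {of_int m + (j m + 1) / N..<of_int m + 1}" (is "?L = ?R")
proof -
  have j: "j m + 1 \<le> N"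
    using assms mod_less_divisor[of N "floor_log (nat m)"]
    unfolding j_def arc_index_def by linarith
  have le1: "(j m + 1) / N \<le> 1" and j0: "0 \<le> j m / N" "j m / N \<le> (j m + 1) / N"
    using j assms by (auto simp: field_simps)
  have "t \<in> avoiding_set N \<longleftrightarrow> t < of_int m + j m / N \<or> of_int m + (j m + 1) / N \<le> t"
    if "of_int m \<le> t" "t < of_int m + 1" for t
  proof -
    have fl: "\<lfloor>t\<rfloor> = m"
      using that by linarith
    have "t \<notin> avoiding_set N \<longleftrightarrow> j m \<le> N * (t - of_int m) \<and> N * (t - of_int m) < j m + 1"
      by (simp add: avoiding_set_def frac_def fl j_def floor_eq_iff)
    also have "\<dots> \<longleftrightarrow> j m / N \<le> t - of_int m \<and> t - of_int m < (j m + 1) / N"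
      using assms by (simp add: field_simps)
    finally show ?thesis
      by linarith
  qed
  then show ?thesis
    using le1 j0 by force
qed

lemma measure_avoiding_set:
  assumes "N \<ge> 1"
  shows "avoiding_set N \<inter> {of_int m .. of_int m + 1} \<in> sets lebesgue"
    and "emeasure lebesgue (avoiding_set N \<inter> {of_int m .. of_int m + 1}) = ennreal (1 - 1 / real N)"
proof -
  define j where "j = real (arc_index N m)"
  define A where "A = {of_int m..<of_int m + j / N}"
  define B where "B = {of_int m + (j + 1) / N..<of_int m + 1}"
  have j: "0 \<le> j" "j + 1 \<le> N"
    using assms mod_less_divisor[of N "floor_log (nat m)"]
    unfolding j_def arc_index_def by linarith+
  have le: "0 \<le> j / N" "(j + 1) / N \<le> 1" "j / N \<le> (j + 1) / N"
    using j assms by (auto simp: field_simps)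
  have "emeasure lborel (A \<union> B) = emeasure lborel A + emeasure lborel B"
    using le by (intro plus_emeasure[symmetric]) (auto simp: A_def B_def)
  also have "\<dots> = ennreal (j / N + (1 - (j + 1) / N))"
    using le by (simp add: A_def B_def ennreal_plus[symmetric] del: ennreal_plus)
  also have "j / N + (1 - (j + 1) / N) = 1 - 1 / N"
    by (simp add: add_divide_distrib)
  finally have AB: "emeasure lebesgue (A \<union> B) = ennreal (1 - 1 / N)"
    by (simp add: A_def B_def)
  have AB_sets: "A \<union> B \<in> sets lebesgue"
    by (simp add: A_def B_def)
  \<comment> \<open>The right endpoint has floor \<open>m + 1\<close> and is governed by the next
    arc index, but one point is a null set.\<close>
  define P where "P = avoiding_set N \<inter> {of_int m + 1 :: real}"
  have "finite P"
    by (simp add: P_def)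
  then have P: "P \<in> null_sets lebesgue"
    by (simp add: finite_imp_null_set_lborel null_sets_completionI)
  have "avoiding_set N \<inter> {of_int m .. of_int m + 1} =
      (avoiding_set N \<inter> {of_int m..<of_int m + 1}) \<union> P"
    unfolding P_def by auto
  also have "\<dots> = (A \<union> B) \<union> P"
    unfolding A_def B_def j_def avoiding_set_Int_unit_interval[OF assms] ..
  finally have eq: "avoiding_set N \<inter> {of_int m .. of_int m + 1} = (A \<union> B) \<union> P" .
  show "avoiding_set N \<inter> {of_int m .. of_int m + 1} \<in> sets lebesgue"
    unfolding eq using AB_sets P by blast
  show "emeasure lebesgue (avoiding_set N \<inter> {of_int m .. of_int m + 1}) = ennreal (1 - 1 / real N)"
    unfolding eq using emeasure_Un_null_set[OF AB_sets P] AB by simp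
qed

lemma not_in_avoiding_setI:
  assumes "2 ^ k \<le> t" "t < 2 ^ Suc k" and "\<lfloor>real N * frac t\<rfloor> = int (k mod N)"
  shows "t \<notin> avoiding_set N"
proof -
  have "2 ^ k \<le> \<lfloor>t\<rfloor>" "\<lfloor>t\<rfloor> < 2 ^ Suc k"
    using assms(1,2) by (simp_all add: le_floor_iff floor_less_iff)
  then have "2 ^ k \<le> nat \<lfloor>t\<rfloor>" "nat \<lfloor>t\<rfloor> < 2 ^ Suc k"
    by (auto simp: nat_less_iff le_nat_iff simp del: power_Suc)
  then have "floor_log (nat \<lfloor>t\<rfloor>) = k"
    using zero_less_power[of "2::nat" k] by (intro floor_log_eqI) (linarith | simp)+
  then show ?thesis
    using assms(3) by (simp add: avoiding_set_def arc_index_def)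
qed

lemma progression_enters:
  fixes x D b :: real
  assumes "D > 0" "x \<le> b"
  obtains n :: nat where "b \<le> x + real n * D" "x + real n * D < b + D"
proof
  define n where "n = nat \<lceil>(b - x) / D\<rceil>"
  have "0 \<le> (b - x) / D"
    using assms by simp
  then have "(b - x) / D \<le> real n" "real n < (b - x) / D + 1"
    unfolding n_def by linarith+
  then show "b \<le> x + real n * D" "x + real n * D < b + D"
    using assms by (simp_all add: field_simps)
qed

text \<open>Steps of length \<open>\<bar>e\<bar>\<close> cannot jump over a half-open interval of
  that length, and an integer is at distance at most 1 in either direction. The bound on
  \<open>i\<close> does not depend on \<open>y\<close>, so a window can be fixed before the starting
  point of the walk.\<close>

lemma small_steps_pass_integer:
  fixes y e :: real
  assumes "e \<noteq> 0"
  obtains i :: nat and z :: int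
  where "real i \<le> 1 / \<bar>e\<bar> + 1" "of_int z \<le> y + real i * e" "y + real i * e < of_int z + \<bar>e\<bar>"
proof (cases "e > 0")
  case True
  obtain i :: nat where i: "of_int \<lceil>y\<rceil> \<le> y + real i * e" "y + real i * e < of_int \<lceil>y\<rceil> + e"
    using progression_enters[OF True, of y "of_int \<lceil>y\<rceil>"] by (auto intro: le_of_int_ceiling)
  have "real i * e \<le> 1 + e"
    using i(2) by linarith
  then have "real i \<le> 1 / e + 1"
    using True by (simp add: field_simps)
  with i True that show thesis
    by (metis abs_of_pos)
next
  case False
  then have e: "- e > 0"
    using assms by simp
  \<comment> \<open>The largest number of downward steps from \<open>y\<close> that stay at or above
    \<open>\<lfloor>y\<rfloor>\<close>.\<close>
  define i where "i = nat \<lfloor>frac y / (- e)\<rfloor>"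
  have "0 \<le> frac y / (- e)"
    using e by (intro divide_nonneg_pos) auto
  then have "real i \<le> frac y / (- e)" "frac y / (- e) < real i + 1"
    unfolding i_def by linarith+
  then have i: "real i * (- e) \<le> frac y" "frac y < (real i + 1) * (- e)"
    using e by (simp_all add: field_simps)
  have "real i * (- e) \<le> 1"
    using i(1) frac_lt_1[of y] by linarith
  then have "real i \<le> 1 / (- e)"
    using e by (simp add: field_simps)
  with i e that[of i "\<lfloor>y\<rfloor>"] show thesis
    by (simp add: frac_def algebra_simps)
qed

lemma power_2_unbounded_residue:
  fixes B :: real
  assumes "j < N"
  obtains k where "B \<le> 2 ^ k" "k mod N = j"
proof
  let ?k = "j + N * nat \<lceil>B\<rceil>"
  have "nat \<lceil>B\<rceil> \<le> N * nat \<lceil>B\<rceil>"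
    using assms by (cases N) auto
  then have "B \<le> real ?k"
    by linarith
  also have "\<dots> \<le> 2 ^ ?k"
    by (rule less_imp_le[OF of_nat_less_two_power])
  finally show "B \<le> 2 ^ ?k" .
  show "?k mod N = j"
    using assms by simp
qed

lemma progression_not_subset_avoiding_set:
  fixes x \<Delta> :: real
  assumes "N \<ge> 1" "\<Delta> > 0"
  shows "\<not> {x + real n * \<Delta> | n :: nat. True} \<subseteq> avoiding_set N"
proof -
  have N: "N > 0" "0 < real N"
    using assms by auto
  obtain p q' :: int where q': "0 < q'" "\<bar>of_int q' * \<Delta> - of_int p\<bar> < 1 / N"
    using Dirichlet_approx[OF N(1), of \<Delta>] by metis
  define q where "q = nat q'"
  define D where "D = real q * \<Delta>"
  define e where "e = D - of_int p"
  have D: "D > 0" and e: "\<bar>e\<bar> < 1 / N"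
    using q' assms by (auto simp: D_def e_def q_def)
  have "\<exists>n. x + real n * D \<notin> avoiding_set N"
  proof (cases "e = 0")
    case True
    define j where "j = nat \<lfloor>real N * frac x\<rfloor>"
    have j: "\<lfloor>real N * frac x\<rfloor> = int j"
      using frac_ge_0[of x] by (simp add: j_def)
    have "real N * frac x < real N"
      using N frac_lt_1[of x] by simp
    then have "j < N"
      using j by linarith
    \<comment> \<open>The window has length \<open>2 ^ k \<ge> D\<close>, so the first term past
      \<open>2 ^ k\<close> is still inside it.\<close>
    then obtain k where k: "max x D \<le> 2 ^ k" "k mod N = j"
      using power_2_unbounded_residue by blast
    obtain n where n: "2 ^ k \<le> x + real n * D" "x + real n * D < 2 ^ k + D"
      using progression_enters[OF D, of x "2 ^ k"] k(1) by auto
    have "real n * D = of_int (int n * p)"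
      using True by (simp add: e_def)
    then have "frac (x + real n * D) = frac x"
      by (simp only: frac_def floor_add_int[symmetric] of_int_add)
    then show ?thesis
      using n k j not_in_avoiding_setI[of k "x + real n * D" N] by auto
  next
    case False
    define R where "R = 1 / \<bar>e\<bar> + 1"
    \<comment> \<open>The window must hold the overshoot on entry, less than \<open>D\<close>, and a
      walk of at most \<open>R\<close> further steps. Residue 0 selects the arc just after an
      integer, where the walk ends.\<close>
    obtain k where k: "max x ((R + 1) * D) \<le> 2 ^ k" "k mod N = 0"
      using power_2_unbounded_residue[of 0 N] N by blast
    obtain n where n: "2 ^ k \<le> x + real n * D" "x + real n * D < 2 ^ k + D"
      using progression_enters[OF D, of x "2 ^ k"] k(1) by auto
    obtain i z where i: "real i \<le> R" "of_int z \<le> x + real n * D + real i * e"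
        "x + real n * D + real i * e < of_int z + \<bar>e\<bar>"
      using small_steps_pass_integer[OF False] unfolding R_def by metis
    define t where "t = x + real (n + i) * D"
    have t: "t = x + real n * D + real i * D"
      by (simp add: t_def algebra_simps)
    have "real i * D \<le> R * D" "0 \<le> real i * D"
      using i(1) D by simp_all
    moreover have "R * D + D \<le> 2 ^ k"
      using k(1) by (simp add: distrib_right)
    ultimately have window: "2 ^ k \<le> t" "t < 2 ^ Suc k"
      using n unfolding t power_Suc by linarith+
    \<comment> \<open>Modulo 1, a step of \<open>D\<close> is a step of \<open>e\<close>, so the
      walk by \<open>e\<close> gives the fractional part of the actual term
      \<open>t\<close>.\<close>
    have tz: "t = x + real n * D + real i * e + of_int (int i * p)"
      by (simp add: t e_def algebra_simps)
    have "1 / real N \<le> 1"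
      using assms by simp
    then have "\<lfloor>x + real n * D + real i * e\<rfloor> = z"
      using i(2,3) e by (intro floor_unique) linarith+
    then have "\<lfloor>t\<rfloor> = z + int i * p"
      by (simp only: tz floor_add_int[symmetric])
    then have "frac t = x + real n * D + real i * e - of_int z"
      by (simp add: frac_def tz)
    then have "0 \<le> frac t" "frac t < 1 / N"
      using i(2,3) e by linarith+
    then have "\<lfloor>real N * frac t\<rfloor> = 0"
      using N by (simp add: floor_eq_iff field_simps)
    then have "t \<notin> avoiding_set N"
      using window k(2) not_in_avoiding_setI by simp
    then show ?thesis
      unfolding t_def by blast
  qed
  \<comment> \<open>Multiples of \<open>D\<close> are multiples of \<open>\<Delta>\<close>, so the
    missing point lies on the original progression.\<close>
  then obtain n where "x + real (n * q) * \<Delta> \<notin> avoiding_set N"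
    by (auto simp: D_def mult.assoc)
  then show ?thesis
    by blast
qed

theorem theorem1p1:
  fixes N :: nat
  assumes "N \<ge> 1"
  shows "\<exists>S :: real set.
    (\<forall>m :: int.
        S \<inter> {of_int m .. of_int m + 1} \<in> sets lebesgue \<and>
        emeasure lebesgue (S \<inter> {of_int m .. of_int m + 1}) = ennreal (1 - 1 / real N)) \<and>
    (\<forall>x \<in> S. \<forall>\<Delta> :: real. \<Delta> > 0 \<longrightarrow> \<not> {x + real n * \<Delta> | n :: nat. True} \<subseteq> S)"
  using measure_avoiding_set[OF assms] progression_not_subset_avoiding_set[OF assms]
  by (intro exI[of _ "avoiding_set N"] conjI allI ballI impI)

end
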